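(* Let $(R,\mathfrak m)$ be a Noetherian local ring of characteristic $p>0$, and $I$ a proper ideal of $R$. If $n=\mu(I)$ is the minimal number of generators of $I$ and $w$ is any nonnegative integer, then \[(I^{n+w})^{-\mathrm{sp}}\subseteq(I^{w+1})^{*\mathrm{sp}}.\]
   Context: $\overline{A}$ denotes the integral closure of an ideal $A$. The special part of the integral closure of an ideal $J$ is $J^{-\mathrm{sp}}:=\{x\in R : \exists\, s\ge1 \text{ such that } x^s\in\overline{\mathfrak m J^s}\}$. For $q=p^e$, $J^{[q]}$ is the ideal generated by $q$-th powers of elements of $J$, and $A^*$ denotes the tight closure of an ideal $A$: $x\in A^*$ iff there is $c\in R$, not in any minimal prime of $R$, with $cx^q\in A^{[q]}$ for all $q=p^e\gg0$. The special part of the tight closure of $J$ is $J^{*\mathrm{sp}}:=\{z\in R : \exists\, q=p^e \text{ such that } z^q\in(\mathfrak m J^{[q]})^*\}$.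
   Formalization: The formal statement assumes n + w > 0, excluding only I = 0 with w = 0; there, with I^0 = R, the claim would say that the maximal ideal lies in the nilradical, which is false for F_p[[t]]. *)

theory Defs
  imports "HOL-Algebra.Algebra" "HOL-Computational_Algebra.Primes"
begin

locale noetherian_local_ring = cring R + noetherian_ring R for R (structure) +
  fixes \<mm> :: "'a set"
  assumes maximalideal_\<mm>: "maximalideal \<mm> R"
    and maximalideal_unique: "maximalideal M R \<Longrightarrow> M = \<mm>"

definition ring_char :: "('a, 'b) ring_scheme \<Rightarrow> nat" where
  "ring_char R =
    (if \<exists>n::nat. 0 < n \<and> add_pow R n \<one>\<^bsub>R\<^esub> = \<zero>\<^bsub>R\<^esub>
     then LEAST n::nat. 0 < n \<and> add_pow R n \<one>\<^bsub>R\<^esub> = \<zero>\<^bsub>R\<^esub> else 0)"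

text \<open>Powers in the multiplicative monoid of ideals, whose unit is the whole ring; in particular
  \<open>I\<^sup>0\<close> is \<open>carrier R\<close>, also for the zero ideal.\<close>

definition ideal_pow :: "('a, 'b) ring_scheme \<Rightarrow> 'a set \<Rightarrow> nat \<Rightarrow> 'a set" where
  "ideal_pow R I k = I [^]\<^bsub>ideals_set R\<^esub> k"

definition min_num_gens :: "('a, 'b) ring_scheme \<Rightarrow> 'a set \<Rightarrow> nat" where
  "min_num_gens R I =
    (LEAST n. \<exists>S \<subseteq> carrier R. finite S \<and> card S = n \<and> I = Idl\<^bsub>R\<^esub> S)"

definition minimal_prime :: "('a, 'b) ring_scheme \<Rightarrow> 'a set \<Rightarrow> bool" where
  "minimal_prime R P \<longleftrightarrow> primeideal P R \<and> (\<forall>Q. primeideal Q R \<and> Q \<subseteq> P \<longrightarrow> Q = P)"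

text \<open>\<open>x\<close> is integral over \<open>I\<close> if it satisfies an equation
  \<open>x\<^sup>n + a\<^sub>1 x\<^sup>n\<^sup>-\<^sup>1 + \<dots> + a\<^sub>n = 0\<close> with \<open>n \<ge> 1\<close> and \<open>a\<^sub>i \<in> I\<^sup>i\<close>.\<close>

definition integral_closure :: "('a, 'b) ring_scheme \<Rightarrow> 'a set \<Rightarrow> 'a set" where
  "integral_closure R I = {x \<in> carrier R. \<exists>n a. 1 \<le> n \<and> (\<forall>i \<in> {1..n}. a i \<in> ideal_pow R I i) \<and>
     x [^]\<^bsub>R\<^esub> (n::nat) \<oplus>\<^bsub>R\<^esub> (\<Oplus>\<^bsub>R\<^esub>i \<in> {1..n}. a i \<otimes>\<^bsub>R\<^esub> x [^]\<^bsub>R\<^esub> (n - i)) = \<zero>\<^bsub>R\<^esub>}"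

definition integral_closure_sp ::
    "('a, 'b) ring_scheme \<Rightarrow> 'a set \<Rightarrow> 'a set \<Rightarrow> 'a set" where
  "integral_closure_sp R \<mm> J = {x \<in> carrier R. \<exists>s\<ge>1.
     x [^]\<^bsub>R\<^esub> (s::nat) \<in> integral_closure R (\<mm> \<cdot>\<^bsub>R\<^esub> ideal_pow R J s)}"

definition frobenius_power :: "('a, 'b) ring_scheme \<Rightarrow> 'a set \<Rightarrow> nat \<Rightarrow> 'a set" where
  "frobenius_power R J q = Idl\<^bsub>R\<^esub> ((\<lambda>x. x [^]\<^bsub>R\<^esub> q) ` J)"

definition tight_closure :: "('a, 'b) ring_scheme \<Rightarrow> nat \<Rightarrow> 'a set \<Rightarrow> 'a set" where
  "tight_closure R p A = {x \<in> carrier R. \<exists>c \<in> carrier R. (\<forall>P. minimal_prime R P \<longrightarrow> c \<notin> P) \<and>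
     (\<exists>e\<^sub>0. \<forall>e\<ge>e\<^sub>0. c \<otimes>\<^bsub>R\<^esub> x [^]\<^bsub>R\<^esub> (p ^ e) \<in> frobenius_power R A (p ^ e))}"

definition tight_closure_sp ::
    "('a, 'b) ring_scheme \<Rightarrow> 'a set \<Rightarrow> nat \<Rightarrow> 'a set \<Rightarrow> 'a set" where
  "tight_closure_sp R \<mm> p J = {z \<in> carrier R. \<exists>e.
     z [^]\<^bsub>R\<^esub> (p ^ e) \<in> tight_closure R p (\<mm> \<cdot>\<^bsub>R\<^esub> frobenius_power R J (p ^ e))}"

end

theory Submission
  imports Defs
begin

text \<open>Let \<open>d = n + w\<close> and let \<open>x\<^sup>s\<close> be integral over \<open>A = \<mm>I\<^sup>d\<^sup>s\<close>. The equation of integral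
  dependence gives a constant \<open>N\<close> with \<open>x\<^sup>s\<^sup>k \<in> A\<^sup>k\<^sup>-\<^sup>N\<close> for all \<open>k\<close>. The bounded loss in the exponent
  of \<open>I\<close> is absorbed by a multiplier \<open>c = c\<^sub>1 + c\<^sub>2\<close> with \<open>c\<^sub>1\<close> in a high power of \<open>I\<close> and \<open>c\<^sub>2\<close>
  annihilating a fixed power of \<open>x\<close>; since \<open>x\<close> lies in every prime containing \<open>I\<close>, prime
  avoidance makes \<open>c\<close> avoid the finitely many minimal primes. The loss in the exponent of \<open>\<mm>\<close> is
  harmless once \<open>q\<^sub>0\<close> is large compared with \<open>s\<close>, \<open>N\<close> and the number of generators of \<open>\<mm>\<close>. So, with
  \<open>Q = q\<^sub>0q\<close>, the element \<open>cx\<^sup>Q\<close> lies in \<open>\<mm>\<^sup>M I\<^sup>d\<^sup>Q\<close> with \<open>M\<close> large, and by the pigeonhole principle on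
  monomials in the generators this is contained in \<open>\<mm>^[q] J^[Q] \<subseteq> (\<mm> J^[q\<^sub>0])^[q]\<close> for
  \<open>J = I\<^sup>w\<^sup>+\<^sup>1\<close>.\<close>

section \<open>Powers of ideals\<close>

context cring
begin

lemma ideal_add_closed: "\<lbrakk>ideal K R; a \<in> K; b \<in> K\<rbrakk> \<Longrightarrow> a \<oplus> b \<in> K"
  by (simp add: additive_subgroup.a_closed ideal.axioms(1))

lemma ideal_zero_closed: "ideal K R \<Longrightarrow> \<zero> \<in> K"
  by (simp add: additive_subgroup.zero_closed ideal.axioms(1))

lemma ideal_uminus_closed:
  assumes "ideal K R" "a \<in> K"
  shows "\<ominus> a \<in> K"
  using ideal.I_l_closed[OF assms, of "\<ominus> \<one>"] ideal.Icarr[OF assms] by (simp add: l_minus)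

lemma ideal_finsum_closed:
  assumes "ideal K R" "finite A" "\<And>i. i \<in> A \<Longrightarrow> f i \<in> K"
  shows "finsum R f A \<in> K"
  using assms(2,3)
proof (induction A rule: finite_induct)
  case empty
  then show ?case using assms(1) by (simp add: ideal_zero_closed)
next
  case (insert i A)
  have "finsum R f (insert i A) = f i \<oplus> finsum R f A"
    using insert ideal.Icarr[OF assms(1)] by (intro finsum_insert) auto
  then show ?case using insert by (simp add: ideal_add_closed assms(1))
qed

text \<open>Since multiplication by \<open>b\<close> is linear, the elements that it sends into
  \<open>K\<close> form an ideal. A statement \<open>a \<otimes> b \<in> K\<close> about all
  \<open>a\<close> in a generated ideal thus needs checking on generators only.\<close>

lemma colon_ideal:
  assumes "ideal K R" "b \<in> carrier R"
  shows "ideal {a \<in> carrier R. a \<otimes> b \<in> K} R"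
proof (rule idealI[OF ring_axioms])
  show "subgroup {a \<in> carrier R. a \<otimes> b \<in> K} (add_monoid R)"
  proof (rule add.subgroupI)
    show "{a \<in> carrier R. a \<otimes> b \<in> K} \<noteq> {}"
      using assms by (auto intro!: exI[of _ \<zero>] simp: ideal_zero_closed)
  qed (use assms in \<open>auto simp: l_distr ideal_add_closed l_minus ideal_uminus_closed
        simp flip: a_inv_def\<close>)
next
  fix a x
  assume a: "a \<in> {a \<in> carrier R. a \<otimes> b \<in> K}" and x: "x \<in> carrier R"
  then show "x \<otimes> a \<in> {a \<in> carrier R. a \<otimes> b \<in> K}"
    using assms by (simp add: m_assoc ideal.I_l_closed)
  then show "a \<otimes> x \<in> {a \<in> carrier R. a \<otimes> b \<in> K}"
    using a x by (simp add: m_comm)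
qed

lemma genideal_mult_mem:
  assumes K: "ideal K R" and S: "S \<subseteq> carrier R" and T: "T \<subseteq> carrier R"
    and ST: "\<And>s t. \<lbrakk>s \<in> S; t \<in> T\<rbrakk> \<Longrightarrow> s \<otimes> t \<in> K"
    and x: "x \<in> Idl S" and y: "y \<in> Idl T"
  shows "x \<otimes> y \<in> K"
proof -
  have xt: "x \<otimes> t \<in> K" if "t \<in> T" for t
  proof -
    have "Idl S \<subseteq> {a \<in> carrier R. a \<otimes> t \<in> K}"
      using S T ST that by (intro genideal_minimal colon_ideal K) auto
    then show ?thesis using x by auto
  qed
  have xc: "x \<in> carrier R"
    by (rule ideal.Icarr[OF genideal_ideal[OF S] x])
  have "Idl T \<subseteq> {a \<in> carrier R. a \<otimes> x \<in> K}"
    using T xt xc by (intro genideal_minimal colon_ideal K) (auto simp: m_comm subset_iff)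
  then show ?thesis using y xc by (auto simp: m_comm)
qed

lemma ideal_prod_subset:
  assumes "ideal K R" "\<And>a b. \<lbrakk>a \<in> A; b \<in> B\<rbrakk> \<Longrightarrow> a \<otimes> b \<in> K"
  shows "A \<cdot> B \<subseteq> K"
proof
  fix z assume "z \<in> A \<cdot> B"
  then show "z \<in> K"
    by (induction rule: ideal_prod.induct) (auto simp: assms ideal_add_closed)
qed

lemma ideal_prod_mono:
  assumes "A \<subseteq> A'" "B \<subseteq> B'"
  shows "A \<cdot> B \<subseteq> A' \<cdot> B'"
proof
  fix z assume "z \<in> A \<cdot> B"
  then show "z \<in> A' \<cdot> B'"
    using assms by (induction rule: ideal_prod.induct) (auto intro: ideal_prod.intros)
qed

lemma ideal_pow_0 [simp]: "ideal_pow R I 0 = carrier R"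
  by (simp add: ideal_pow_def ideals_set_def)

lemma ideal_pow_Suc: "ideal_pow R I (Suc k) = ideal_pow R I k \<cdot> I"
  by (simp add: ideal_pow_def ideals_set_def)

lemma ideal_pow_ideal [simp]:
  assumes "ideal I R"
  shows "ideal (ideal_pow R I k) R"
  using assms by (induction k) (auto simp: oneideal ideal_pow_Suc ideal_prod_is_ideal)

lemma ideal_pow_1:
  assumes "ideal I R"
  shows "ideal_pow R I (Suc 0) = I"
  using assms by (simp add: ideal_pow_Suc ideal_prod_commute[of "carrier R" I] oneideal ideal_prod_one)

text \<open>The definition of \<open>ideal_pow\<close> as a power in the commutative monoid
  \<open>ideals_set R\<close> makes this and the next two laws instances of monoid laws.\<close>

lemma ideal_pow_add:
  assumes "ideal I R"
  shows "ideal_pow R I j \<cdot> ideal_pow R I k = ideal_pow R I (j + k)"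
proof -
  interpret IS: comm_monoid "ideals_set R" by (rule ideals_set_is_comm_monoid)
  show ?thesis
    using IS.nat_pow_mult[of I j k] assms by (simp add: ideal_pow_def ideals_set_def)
qed

lemma ideal_pow_pow:
  assumes "ideal I R"
  shows "ideal_pow R (ideal_pow R I j) k = ideal_pow R I (j * k)"
proof -
  interpret IS: comm_monoid "ideals_set R" by (rule ideals_set_is_comm_monoid)
  show ?thesis
    using IS.nat_pow_pow[of I j k] assms by (simp add: ideal_pow_def ideals_set_def)
qed

lemma ideal_pow_prod:
  assumes "ideal I R" "ideal J R"
  shows "ideal_pow R (I \<cdot> J) k = ideal_pow R I k \<cdot> ideal_pow R J k"
proof -
  interpret IS: comm_monoid "ideals_set R" by (rule ideals_set_is_comm_monoid)
  show ?thesis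
    using IS.nat_pow_distrib[of I J k] assms by (simp add: ideal_pow_def ideals_set_def)
qed

lemma ideal_pow_antimono:
  assumes "ideal I R" "j \<le> k"
  shows "ideal_pow R I k \<subseteq> ideal_pow R I j"
proof -
  have "ideal_pow R I k = ideal_pow R I j \<cdot> ideal_pow R I (k - j)"
    using assms by (simp add: ideal_pow_add)
  then show ?thesis
    using ideal_prod_inter[of "ideal_pow R I j" "ideal_pow R I (k - j)"] assms(1) by auto
qed

lemma primeideal_ideal_pow_subset:
  assumes "primeideal P R" "ideal I R" "ideal_pow R I k \<subseteq> P"
  shows "I \<subseteq> P"
  using assms(3)
proof (induction k)
  case 0
  then show ?case using assms(2) by (auto dest: ideal.Icarr)
next
  case (Suc k)
  then show ?case
    using primeideal_divides_ideal_prod[OF assms(1), of "ideal_pow R I k" I] assms(2)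
    by (auto simp: ideal_pow_Suc)
qed

lemma primeideal_pow_mem:
  assumes "primeideal P R" "x \<in> carrier R" "x [^] (k::nat) \<in> P"
  shows "x \<in> P"
proof -
  interpret P: primeideal P R by fact
  show ?thesis
    using assms(3)
  proof (induction k)
    case 0
    then show ?case using P.I_notcarr P.one_imp_carrier by auto
  next
    case (Suc k)
    then show ?case using P.I_prime[of "x [^] k" x] assms(2) by auto
  qed
qed

text \<open>Induction on \<open>k\<close> with \<open>K\<close> arbitrary: fixing the generator
  \<open>b\<close> as one factor, the induction hypothesis applies to the colon ideal of
  \<open>K\<close> by \<open>b\<close>. A second colon argument passes from generators
  \<open>b\<close> to all of \<open>Idl S\<close>.\<close>

lemma ideal_pow_genideal_subset:
  assumes S: "S \<subseteq> carrier R" and K: "ideal K R"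
    and "\<And>xs. \<lbrakk>set xs \<subseteq> S; length xs = k\<rbrakk> \<Longrightarrow> foldr (\<otimes>) xs \<one> \<in> K"
  shows "ideal_pow R (Idl S) k \<subseteq> K"
  using K assms(3)
proof (induction k arbitrary: K)
  case 0
  then show ?case using ideal.one_imp_carrier[of K R] by auto
next
  case (Suc k)
  have 1: "a \<otimes> b \<in> K" if "b \<in> S" "a \<in> ideal_pow R (Idl S) k" for a b
  proof -
    have b: "b \<in> carrier R" using that S by auto
    have "ideal_pow R (Idl S) k \<subseteq> {a \<in> carrier R. a \<otimes> b \<in> K}"
    proof (rule Suc.IH[OF colon_ideal[OF Suc.prems(1) b]])
      fix xs assume xs: "set xs \<subseteq> S" "length xs = k"
      then have "foldr (\<otimes>) (b # xs) \<one> \<in> K"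
        using that by (intro Suc.prems(2)) auto
      moreover have "foldr (\<otimes>) xs \<one> \<in> carrier R"
        using xs S by (intro multlist_closed) auto
      ultimately show "foldr (\<otimes>) xs \<one> \<in> {a \<in> carrier R. a \<otimes> b \<in> K}"
        using b by (simp add: m_comm)
    qed
    then show ?thesis using that by auto
  qed
  have "a \<otimes> b \<in> K" if a: "a \<in> ideal_pow R (Idl S) k" and b: "b \<in> Idl S" for a b
  proof -
    have ac: "a \<in> carrier R"
      using a by (rule ideal.Icarr[OF ideal_pow_ideal[OF genideal_ideal[OF S]]])
    have "Idl S \<subseteq> {b \<in> carrier R. b \<otimes> a \<in> K}"
      using S 1[OF _ a] ac
      by (intro genideal_minimal colon_ideal Suc.prems(1)) (auto simp: m_comm subset_iff)
    then show ?thesis using b ac by (auto simp: m_comm)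
  qed
  then show ?case unfolding ideal_pow_Suc by (intro ideal_prod_subset Suc.prems(1))
qed

section \<open>Frobenius powers\<close>

lemma frobenius_power_ideal:
  assumes "ideal J R"
  shows "ideal (frobenius_power R J q) R"
  unfolding frobenius_power_def using ideal.Icarr[OF assms] by (intro genideal_ideal) auto

lemma pow_mem_frobenius_power:
  assumes "ideal J R" "v \<in> J"
  shows "v [^] q \<in> frobenius_power R J q"
  unfolding frobenius_power_def
  using genideal_self[of "(\<lambda>x. x [^] q) ` J"] assms(2) ideal.Icarr[OF assms(1)] by auto

lemma foldr_replicate_mult:
  assumes "a \<in> carrier R" "set ys \<subseteq> carrier R"
  shows "foldr (\<otimes>) (replicate q a @ ys) \<one> = a [^] q \<otimes> foldr (\<otimes>) ys \<one>"
proof (induction q)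
  case 0
  then show ?case using assms by simp
next
  case (Suc q)
  then show ?case
    using assms nat_pow_Suc2[of a q] by (simp add: m_assoc del: nat_pow_Suc)
qed

text \<open>Pigeonhole: some generator occurs at least \<open>Q\<close> times; strip off \<open>Q\<close> copies and repeat.\<close>

lemma long_product_eq_power_mult:
  assumes S: "S \<subseteq> carrier R" "finite S" and I: "I = Idl S" and "0 < Q"
    and "set xs \<subseteq> S" "xs \<noteq> []" "card S * Q + w * Q \<le> length xs"
  shows "\<exists>v \<in> ideal_pow R I (Suc w). \<exists>r \<in> carrier R. foldr (\<otimes>) xs \<one> = v [^] Q \<otimes> r"
  using assms(5-7)
proof (induction w arbitrary: xs)
  have strip: "\<exists>a \<in> S. \<exists>ys. set ys \<subseteq> S \<and> length xs = Q + length ys \<and>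
      foldr (\<otimes>) xs \<one> = a [^] Q \<otimes> foldr (\<otimes>) ys \<one>"
    if xs: "set xs \<subseteq> S" "xs \<noteq> []" "card S * Q \<le> length xs" for xs
  proof -
    have "\<exists>a \<in> S. Q \<le> count (mset xs) a"
    proof (rule ccontr)
      assume "\<not> ?thesis"
      then have "count (mset xs) a \<le> Q - 1" if "a \<in> S" for a using that by force
      then have "(\<Sum>a\<in>S. count (mset xs) a) \<le> card S * (Q - 1)"
        using sum_bounded_above[of S "count (mset xs)" "Q - 1"] by simp
      moreover have "(\<Sum>a\<in>S. count (mset xs) a) = length xs"
        using sum_count_set[OF xs(1) S(2)] by (simp add: count_mset)
      ultimately have "card S * Q \<le> card S * (Q - 1)" using xs(3) by linarith
      \<comment> \<open>For positive \<open>Q\<close> the last inequality leaves only an empty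
        \<open>S\<close>, which \<open>xs \<noteq> []\<close> excludes.\<close>
      then have "card S = 0"
        using \<open>0 < Q\<close> mult_less_mono2[of "Q - 1" Q "card S"] by linarith
      then show False using S(2) xs by simp
    qed
    then obtain a where a: "a \<in> S" "Q \<le> count (mset xs) a" by blast
    then have sub: "replicate_mset Q a \<subseteq># mset xs"
      by (simp add: count_le_replicate_mset_subset_eq)
    obtain ys where ys: "mset ys = mset xs - replicate_mset Q a"
      using ex_mset by blast
    have perm: "mset xs = mset (replicate Q a @ ys)"
      using sub by (simp add: ys)
    have "set xs = set (replicate Q a @ ys)" "length xs = length (replicate Q a @ ys)"
      using mset_eq_setD[OF perm] mset_eq_length[OF perm] by auto
    moreover have "foldr (\<otimes>) xs \<one> = foldr (\<otimes>) (replicate Q a @ ys) \<one>"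
      using perm xs S by (intro multlist_perm_cong) auto
    ultimately show ?thesis
      using a xs S foldr_replicate_mult[of a ys Q] by (intro bexI[of _ a] exI[of _ ys]) auto
  qed
  {
    case 0
    then obtain a ys where a: "a \<in> S" "set ys \<subseteq> S"
        "foldr (\<otimes>) xs \<one> = a [^] Q \<otimes> foldr (\<otimes>) ys \<one>"
      using strip[of xs] by auto
    have "a \<in> ideal_pow R I (Suc 0)"
      using a(1) genideal_self[OF S(1)] by (auto simp: ideal_pow_1 genideal_ideal S I)
    moreover have "foldr (\<otimes>) ys \<one> \<in> carrier R"
      using a(2) S by (intro multlist_closed) auto
    ultimately show ?case using a(3) by blast
  next
    case (Suc w)
    then obtain a ys where a: "a \<in> S" "set ys \<subseteq> S" "length xs = Q + length ys"
        "foldr (\<otimes>) xs \<one> = a [^] Q \<otimes> foldr (\<otimes>) ys \<one>"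
      using strip[of xs] by auto
    \<comment> \<open>The induction hypothesis also asks for a nonempty list; a nonempty
      \<open>S\<close> makes the length bound for \<open>ys\<close> positive.\<close>
    have "card S > 0" using a(1) S(2) by (auto simp: card_gt_0_iff)
    then have "0 < card S * Q" using \<open>0 < Q\<close> by simp
    moreover have len: "card S * Q + w * Q \<le> length ys"
      using Suc.prems(3) a(3) by simp
    ultimately have "ys \<noteq> []" by auto
    then obtain v r where v: "v \<in> ideal_pow R I (Suc w)" "r \<in> carrier R"
        "foldr (\<otimes>) ys \<one> = v [^] Q \<otimes> r"
      using Suc.IH[OF a(2) _ len] by blast
    have vc: "v \<in> carrier R"
      using v(1) ideal.Icarr[OF ideal_pow_ideal[OF genideal_ideal[OF S(1)]]] by (simp add: I)
    have ac: "a \<in> carrier R" using a(1) S by auto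
    have "v \<otimes> a \<in> ideal_pow R I (Suc (Suc w))"
      unfolding ideal_pow_Suc[of I "Suc w"]
      using v(1) a(1) genideal_self[OF S(1)] I by (intro ideal_prod.prod) auto
    moreover have "foldr (\<otimes>) xs \<one> = (v \<otimes> a) [^] Q \<otimes> r"
      using a(4) v(2,3) vc ac by (simp add: nat_pow_distrib m_ac)
    ultimately show ?case using v(2) by blast
  }
qed

text \<open>By the pigeonhole lemma each product of \<open>k\<close> generators is a multiple of
  some \<open>v [^] Q\<close> with \<open>v\<close> in the power \<open>w + 1\<close> of
  \<open>I\<close>. The condition \<open>0 < k\<close> excludes the case of empty \<open>S\<close>
  and \<open>w = 0\<close>, where the power on the left could be the whole ring while
  \<open>I\<close> is zero. It serves for \<open>I\<close> itself and, with \<open>w = 0\<close>,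
  for \<mm>.\<close>

lemma ideal_pow_subset_frobenius_power:
  assumes S: "S \<subseteq> carrier R" "finite S" and I: "I = Idl S" and "0 < Q"
    and "0 < k" "card S * Q + w * Q \<le> k"
  shows "ideal_pow R I k \<subseteq> frobenius_power R (ideal_pow R I (w + 1)) Q"
proof -
  have II: "ideal I R" unfolding I by (rule genideal_ideal[OF S(1)])
  have J: "ideal (frobenius_power R (ideal_pow R I (w + 1)) Q) R"
    using II by (intro frobenius_power_ideal ideal_pow_ideal)
  have "foldr (\<otimes>) xs \<one> \<in> frobenius_power R (ideal_pow R I (w + 1)) Q"
    if xs: "set xs \<subseteq> S" "length xs = k" for xs
  proof -
    have "xs \<noteq> []" using xs \<open>0 < k\<close> by auto
    then obtain v r where v: "v \<in> ideal_pow R I (Suc w)" "r \<in> carrier R"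
        "foldr (\<otimes>) xs \<one> = v [^] Q \<otimes> r"
      using long_product_eq_power_mult[OF S I \<open>0 < Q\<close> xs(1)] xs(2) assms(6) by blast
    then show ?thesis
      using ideal.I_r_closed[OF J pow_mem_frobenius_power v(2), of v] II by simp
  qed
  then show ?thesis unfolding I by (intro ideal_pow_genideal_subset S J[unfolded I])
qed

text \<open>On generators, u^q v^(q'q) = (u v^q')^q, and u v^q' lies in the product of
  \<open>A\<close> with the Frobenius power of \<open>B\<close>.\<close>

lemma frobenius_power_prod_subset:
  assumes A: "ideal A R" and B: "ideal B R"
  shows "frobenius_power R A q \<cdot> frobenius_power R B (q' * q)
    \<subseteq> frobenius_power R (A \<cdot> frobenius_power R B q') q"
proof -
  let ?J = "A \<cdot> frobenius_power R B q'"
  have J: "ideal ?J R" by (intro ideal_prod_is_ideal A frobenius_power_ideal B)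
  have K: "ideal (frobenius_power R ?J q) R" by (rule frobenius_power_ideal[OF J])
  show ?thesis
  proof (rule ideal_prod_subset[OF K])
    fix x y assume "x \<in> frobenius_power R A q" "y \<in> frobenius_power R B (q' * q)"
    then show "x \<otimes> y \<in> frobenius_power R ?J q"
      unfolding frobenius_power_def[of R A] frobenius_power_def[of R B "q' * q"]
    proof (rule genideal_mult_mem[OF K, rotated -2])
      fix s t assume "s \<in> (\<lambda>x. x [^] q) ` A" "t \<in> (\<lambda>x. x [^] (q' * q)) ` B"
      then obtain u v where uv: "u \<in> A" "v \<in> B" "s = u [^] q" "t = v [^] (q' * q)" by blast
      have c: "u \<in> carrier R" "v \<in> carrier R"
        using uv A B by (auto dest: ideal.Icarr)
      have "u \<otimes> v [^] q' \<in> ?J"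
        using uv pow_mem_frobenius_power[OF B] by (intro ideal_prod.prod)
      then have "(u \<otimes> v [^] q') [^] q \<in> frobenius_power R ?J q"
        by (rule pow_mem_frobenius_power[OF J])
      then show "s \<otimes> t \<in> frobenius_power R ?J q"
        using uv c by (simp add: nat_pow_distrib nat_pow_pow)
    qed (use A B in \<open>auto dest: ideal.Icarr\<close>)
  qed
qed

section \<open>Powers of integral elements\<close>

text \<open>With an equation of degree \<open>n\<close>, the loss is \<open>N = n - 1\<close>.
  Multiplying the equation by y^(k-n) expresses y^k through the terms a_i y^(k-i), to which strong
  induction applies.\<close>

lemma integral_closure_pow_mem:
  assumes A: "ideal A R" and y: "y \<in> integral_closure R A"
  obtains N where "\<And>k. y [^] k \<in> ideal_pow R A (k - N)"
proof -
  obtain n a where yc: "y \<in> carrier R" and n: "1 \<le> n"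
    and a: "\<And>i. i \<in> {1..n} \<Longrightarrow> a i \<in> ideal_pow R A i"
    and eq: "y [^] (n::nat) \<oplus> (\<Oplus>i\<in>{1..n}. a i \<otimes> y [^] (n - i)) = \<zero>"
    using y unfolding integral_closure_def by blast
  have ac: "a i \<in> carrier R" if "i \<in> {1..n}" for i
    using a[OF that] ideal.Icarr[OF ideal_pow_ideal[OF A]] by blast
  have "y [^] k \<in> ideal_pow R A (k - (n - 1))" for k
  proof (induction k rule: less_induct)
    case (less k)
    show ?case
    proof (cases "k < n")
      case True
      \<comment> \<open>Truncated subtraction makes the claim trivial here: the zeroth power of
        \<open>A\<close> is the whole ring.\<close>
      then have "k - (n - 1) = 0" by simp
      then show ?thesis using yc by simp
    next
      case False
      let ?K = "ideal_pow R A (k - (n - 1))"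
      let ?z = "y [^] (k - n)"
      let ?s = "\<Oplus>i\<in>{1..n}. a i \<otimes> y [^] (n - i)"
      have K: "ideal ?K R" using A by simp
      have z: "?z \<in> carrier R" using yc by simp
      have "a i \<otimes> y [^] (n - i) \<otimes> ?z \<in> ?K" if i: "i \<in> {1..n}" for i
      proof -
        have "a i \<otimes> y [^] (k - i) \<in> ideal_pow R A i \<cdot> ideal_pow R A (k - i - (n - 1))"
          using i n False by (intro ideal_prod.prod a less) auto
        \<comment> \<open>The exponent \<open>i + (k - i - (n - 1))\<close> is at least
          \<open>k - (n - 1)\<close>; it is larger when the inner subtraction is truncated.\<close>
        moreover have "\<dots> \<subseteq> ?K"
          unfolding ideal_pow_add[OF A] by (intro ideal_pow_antimono A) auto
        moreover have "a i \<otimes> y [^] (n - i) \<otimes> ?z = a i \<otimes> y [^] (k - i)"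
          using ac[OF i] yc i False by (simp add: m_assoc nat_pow_mult)
        ultimately show ?thesis by auto
      qed
      then have "?s \<in> {u \<in> carrier R. u \<otimes> ?z \<in> ?K}"
        using ac yc by (intro ideal_finsum_closed colon_ideal K z) auto
      then have s: "?s \<in> carrier R" "?s \<otimes> ?z \<in> ?K" by auto
      have "y [^] n = \<ominus> ?s"
        using eq s yc by (simp add: minus_equality)
      then have "y [^] n \<otimes> ?z = \<ominus> (?s \<otimes> ?z)"
        using s z by (simp add: l_minus)
      moreover have "y [^] n \<otimes> ?z = y [^] k"
        using yc False by (simp add: nat_pow_mult)
      ultimately show ?thesis using ideal_uminus_closed[OF K s(2)] by simp
    qed
  qed
  then show thesis by (rule that)
qed

section \<open>Minimal primes\<close>

lemma foldr_ideal_prod_ideal: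
  assumes "\<And>P. P \<in> set Ps \<Longrightarrow> ideal P R"
  shows "ideal (foldr (\<cdot>) Ps (carrier R)) R"
  using assms by (induction Ps) (auto simp: oneideal ideal_prod_is_ideal)

lemma foldr_ideal_prod_append:
  assumes "\<And>P. P \<in> set Ps \<union> set Qs \<Longrightarrow> ideal P R"
  shows "foldr (\<cdot>) (Ps @ Qs) (carrier R)
    = foldr (\<cdot>) Ps (carrier R) \<cdot> foldr (\<cdot>) Qs (carrier R)"
  using assms
proof (induction Ps)
  case Nil
  then have "ideal (foldr (\<cdot>) Qs (carrier R)) R" by (intro foldr_ideal_prod_ideal) auto
  then show ?case
    using ideal_prod_commute[of "carrier R"] by (simp add: oneideal ideal_prod_one)
next
  case (Cons P Ps)
  have "ideal (foldr (\<cdot>) Qs (carrier R)) R" "ideal (foldr (\<cdot>) Ps (carrier R)) R"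
    using Cons.prems by (auto intro!: foldr_ideal_prod_ideal)
  then show ?case using Cons by (simp add: ideal_prod_assoc)
qed

lemma primeideal_foldr_ideal_prod_subset:
  assumes "primeideal P R" "\<And>Q. Q \<in> set Ps \<Longrightarrow> ideal Q R"
    and "foldr (\<cdot>) Ps (carrier R) \<subseteq> P"
  shows "\<exists>Q \<in> set Ps. Q \<subseteq> P"
  using assms(2,3)
proof (induction Ps)
  case Nil
  interpret primeideal P R by fact
  show ?case using Nil I_notcarr Icarr by auto
next
  case (Cons Q Ps)
  then show ?case
    using primeideal_divides_ideal_prod[OF assms(1), of Q "foldr (\<cdot>) Ps (carrier R)"]
      foldr_ideal_prod_ideal[of Ps] by auto
qed

text \<open>Each entry of \<open>Ps\<close> is served by one factor \<open>x\<close>: an entry equal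
  to \<open>P\<close> contains \<open>x\<close>, and any other contributes, by minimality, an
  element outside \<open>P\<close>, all of which are collected in \<open>u\<close>. If the product
  of \<open>Ps\<close> is zero, then \<open>u\<close> annihilates a power of \<open>x\<close> whose
  exponent does not depend on \<open>P\<close>.\<close>

lemma minimal_prime_annihilator:
  assumes P: "minimal_prime R P" and x: "x \<in> P"
    and Ps: "\<And>Q. Q \<in> set Ps \<Longrightarrow> primeideal Q R"
  shows "\<exists>u \<in> carrier R - P. u \<otimes> x [^] length Ps \<in> foldr (\<cdot>) Ps (carrier R)"
proof -
  interpret P: primeideal P R using P by (simp add: minimal_prime_def)
  have xc: "x \<in> carrier R" using x by (rule P.Icarr)
  show ?thesis
    using Ps
  proof (induction Ps)
    case Nil
    have "\<one> \<notin> P" using P.I_notcarr P.one_imp_carrier by auto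
    then show ?case using xc by (intro bexI[of _ \<one>]) auto
  next
    case (Cons Q Ps)
    then obtain u where u: "u \<in> carrier R" "u \<notin> P"
        "u \<otimes> x [^] length Ps \<in> foldr (\<cdot>) Ps (carrier R)" by auto
    have Q: "ideal Q R" using Cons.prems by (simp add: primeideal_def)
    show ?case
    proof (cases "Q = P")
      case True
      have "u \<otimes> x [^] length (Q # Ps) = x \<otimes> (u \<otimes> x [^] length Ps)"
        using u xc by (simp add: m_ac)
      also have "\<dots> \<in> foldr (\<cdot>) (Q # Ps) (carrier R)"
        using u(3) x True by (auto intro: ideal_prod.prod)
      finally show ?thesis using u by blast
    next
      case False
      then obtain v where v: "v \<in> Q" "v \<notin> P"
        using P Cons.prems unfolding minimal_prime_def by auto
      have vc: "v \<in> carrier R" using v Q by (auto dest: ideal.Icarr)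
      \<comment> \<open>Here \<open>v\<close> alone lies in \<open>Q\<close>; the factor
        \<open>x\<close> only keeps the exponent equal to the length of the list.\<close>
      have "v \<otimes> x \<in> Q" using v(1) xc Q by (simp add: ideal.I_r_closed)
      then have "(v \<otimes> x) \<otimes> (u \<otimes> x [^] length Ps) \<in> foldr (\<cdot>) (Q # Ps) (carrier R)"
        using u(3) by (auto intro: ideal_prod.prod)
      moreover have "(v \<otimes> x) \<otimes> (u \<otimes> x [^] length Ps) = (v \<otimes> u) \<otimes> x [^] length (Q # Ps)"
        using u xc vc by (simp add: m_ac)
      moreover have "v \<otimes> u \<notin> P" using P.I_prime u v vc by blast
      ultimately show ?thesis using u vc by (intro bexI[of _ "v \<otimes> u"]) auto
    qed
  qed
qed

text \<open>The witness is the product of one element of each \<open>Q\<close> outside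
  \<open>P\<close>; primeness keeps it outside \<open>P\<close>.\<close>

lemma ex_mem_ideals_not_mem_primeideal:
  assumes "finite S" "primeideal P R" "\<And>Q. Q \<in> S \<Longrightarrow> ideal Q R \<and> \<not> Q \<subseteq> P"
  shows "\<exists>u \<in> carrier R - P. \<forall>Q \<in> S. u \<in> Q"
  using assms(1,3)
proof (induction S rule: finite_induct)
  case empty
  interpret primeideal P R by fact
  show ?case using I_notcarr one_imp_carrier by auto
next
  case (insert Q S)
  interpret primeideal P R by fact
  obtain u where u: "u \<in> carrier R" "u \<notin> P" "\<forall>Q \<in> S. u \<in> Q" using insert by auto
  obtain v where v: "v \<in> Q" "v \<notin> P" using insert by auto
  have vc: "v \<in> carrier R" using v insert.prems by (auto dest: ideal.Icarr)
  have "v \<otimes> u \<notin> P" using I_prime u v vc by blast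
  moreover have "\<forall>Q' \<in> insert Q S. v \<otimes> u \<in> Q'"
    using u v vc insert.prems by (auto simp: ideal.I_l_closed ideal.I_r_closed)
  ultimately show ?case using u vc by (intro bexI[of _ "v \<otimes> u"]) auto
qed

text \<open>If \<open>b\<close> avoids \<open>S\<close> but lies in the new prime \<open>P\<close>,
  it is corrected to \<open>b \<oplus> u \<otimes> v\<close> with \<open>v\<close> in
  \<open>B\<close> outside \<open>P\<close> and \<open>u\<close> in every member of \<open>S\<close>
  but not in \<open>P\<close>. The antichain condition provides \<open>u\<close>; minimal primes
  satisfy it.\<close>

lemma prime_avoidance_antichain:
  assumes "finite S" "ideal B R"
    and "\<And>P. P \<in> S \<Longrightarrow> primeideal P R \<and> \<not> B \<subseteq> P"
    and "\<And>P Q. \<lbrakk>P \<in> S; Q \<in> S; Q \<subseteq> P\<rbrakk> \<Longrightarrow> Q = P"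
  shows "\<exists>b \<in> B. \<forall>P \<in> S. b \<notin> P"
  using assms(1,3,4)
proof (induction S rule: finite_induct)
  case empty
  then show ?case using ideal_zero_closed[OF assms(2)] by auto
next
  case (insert P S)
  interpret P: primeideal P R using insert.prems by auto
  have "\<exists>b \<in> B. \<forall>P \<in> S. b \<notin> P"
    by (rule insert.IH) (use insert.prems in auto)
  then obtain b where b: "b \<in> B" "\<forall>P \<in> S. b \<notin> P" by blast
  have bc: "b \<in> carrier R" using b assms(2) by (auto dest: ideal.Icarr)
  show ?case
  proof (cases "b \<in> P")
    case False
    then show ?thesis using b by auto
  next
    case True
    have "ideal Q R \<and> \<not> Q \<subseteq> P" if "Q \<in> S" for Q
      using insert.prems(1)[of Q] insert.prems(2)[of P Q] insert.hyps that
      by (auto simp: primeideal_def)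
    then obtain u where u: "u \<in> carrier R" "u \<notin> P" "\<forall>Q \<in> S. u \<in> Q"
      using ex_mem_ideals_not_mem_primeideal[OF insert.hyps(1) P.primeideal] by auto
    obtain v where v: "v \<in> B" "v \<notin> P" using insert.prems(1)[of P] by auto
    have vc: "v \<in> carrier R" using v assms(2) by (auto dest: ideal.Icarr)
    have uv: "u \<otimes> v \<notin> P" using P.I_prime u v vc by blast
    have cancel: "d \<in> Q" if "ideal Q R" "c \<in> Q" "c \<oplus> d \<in> Q" "d \<in> carrier R" for Q c d
    proof -
      have "\<ominus> c \<oplus> (c \<oplus> d) \<in> Q"
        by (rule ideal_add_closed[OF that(1) ideal_uminus_closed[OF that(1,2)] that(3)])
      then show ?thesis unfolding r_neg1[OF ideal.Icarr[OF that(1,2)] that(4)] .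
    qed
    have "b \<oplus> u \<otimes> v \<in> B"
      using b v u assms(2) by (simp add: ideal_add_closed ideal.I_l_closed)
    moreover have "b \<oplus> u \<otimes> v \<notin> P"
      using cancel[OF P.is_ideal True, of "u \<otimes> v"] uv u vc by auto
    moreover have "b \<oplus> u \<otimes> v \<notin> Q" if "Q \<in> S" for Q
    proof
      assume *: "b \<oplus> u \<otimes> v \<in> Q"
      have Q: "ideal Q R" using insert.prems(1)[of Q] that by (simp add: primeideal_def)
      have "u \<otimes> v \<in> Q" using u(3) that vc Q by (simp add: ideal.I_r_closed)
      then have "b \<in> Q" using cancel[OF Q, of "u \<otimes> v" b] * bc u vc by (simp add: a_comm)
      then show False using b that by auto
    qed
    ultimately show ?thesis by auto
  qed
qed

end

text \<open>Take \<open>M\<close> maximal among the ideals containing no finite product of primes.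
  It is neither the whole ring (empty product) nor prime, so a b \<in> M with \<open>a\<close>,
  \<open>b\<close> outside \<open>M\<close>. The ideals generated by \<open>M\<close> with
  \<open>a\<close> and by \<open>M\<close> with \<open>b\<close> contain such products, and their
  own product lies in \<open>M\<close>. Lists allow repeated primes. Applied to the zero ideal, this
  yields finitely many minimal primes.\<close>

lemma (in noetherian_ring) ex_prime_list_prod_subset:
  assumes "cring R" "ideal I R"
  shows "\<exists>Ps. (\<forall>P \<in> set Ps. primeideal P R) \<and> foldr (\<cdot>) Ps (carrier R) \<subseteq> I"
proof (rule ccontr)
  interpret cring R by fact
  define good where "good I \<longleftrightarrow>
    (\<exists>Ps. (\<forall>P \<in> set Ps. primeideal P R) \<and> foldr (\<cdot>) Ps (carrier R) \<subseteq> I)" for I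
  define \<B> where "\<B> = {I. ideal I R \<and> \<not> good I}"
  assume "\<not> ?thesis"
  then have "I \<in> \<B>" using assms by (auto simp: \<B>_def good_def)
  \<comment> \<open>In a Noetherian ring a nonempty chain of ideals contains its union, which is the
    chain condition for Zorn's lemma.\<close>
  moreover have "\<Union>C \<in> \<B>" if "C \<noteq> {}" "subset.chain \<B> C" for C
  proof -
    have "subset.chain {I. ideal I R} C"
      using that(2) by (auto simp: subset_chain_def \<B>_def)
    then show ?thesis
      using ideal_chain_is_trivial[OF that(1)] that(2) by (auto simp: subset_chain_def)
  qed
  ultimately obtain M where M: "M \<in> \<B>" and max: "\<And>J. \<lbrakk>J \<in> \<B>; M \<subseteq> J\<rbrakk> \<Longrightarrow> J = M"
    using subset_Zorn_nonempty[of \<B>] by blast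
  have Mi: "ideal M R" and bad: "\<not> good M" using M by (auto simp: \<B>_def)
  have Msub: "M \<subseteq> carrier R" using Mi by (auto dest: ideal.Icarr)
  have "M \<noteq> carrier R"
  proof
    assume "M = carrier R"
    then have "good M" unfolding good_def by (intro exI[of _ "[]"]) simp
    then show False using bad by simp
  qed
  moreover have "\<not> primeideal M R"
  proof
    assume "primeideal M R"
    then have "good M"
      unfolding good_def using ideal_prod_one[OF Mi] by (intro exI[of _ "[M]"]) simp
    then show False using bad by simp
  qed
  ultimately obtain a b where ab: "a \<in> carrier R" "b \<in> carrier R" "a \<otimes> b \<in> M" "a \<notin> M" "b \<notin> M"
    using ideal.primeidealCD[OF Mi is_cring] by blast
  have larger: "good (Idl (insert c M))" if "c \<in> carrier R" "c \<notin> M" for c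
  proof (rule ccontr)
    have sub: "insert c M \<subseteq> Idl (insert c M)"
      using that Msub by (intro genideal_self) auto
    assume "\<not> ?thesis"
    then have "Idl (insert c M) \<in> \<B>"
      using that Msub by (auto simp: \<B>_def intro!: genideal_ideal)
    then show False using max sub that by blast
  qed
  obtain Ps where Ps: "\<forall>P \<in> set Ps. primeideal P R"
      "foldr (\<cdot>) Ps (carrier R) \<subseteq> Idl (insert a M)"
    using larger[OF ab(1,4)] by (auto simp: good_def)
  obtain Qs where Qs: "\<forall>P \<in> set Qs. primeideal P R"
      "foldr (\<cdot>) Qs (carrier R) \<subseteq> Idl (insert b M)"
    using larger[OF ab(2,5)] by (auto simp: good_def)
  have "foldr (\<cdot>) (Ps @ Qs) (carrier R)
      = foldr (\<cdot>) Ps (carrier R) \<cdot> foldr (\<cdot>) Qs (carrier R)"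
    using Ps(1) Qs(1) by (intro foldr_ideal_prod_append) (auto simp: primeideal_def)
  also have "\<dots> \<subseteq> (Idl (insert a M)) \<cdot> (Idl (insert b M))"
    by (rule ideal_prod_mono[OF Ps(2) Qs(2)])
  also have "\<dots> \<subseteq> M"
  proof (rule ideal_prod_subset[OF Mi])
    fix x y assume "x \<in> Idl (insert a M)" "y \<in> Idl (insert b M)"
    then show "x \<otimes> y \<in> M"
    proof (rule genideal_mult_mem[OF Mi, rotated -2])
      fix s t assume "s \<in> insert a M" "t \<in> insert b M"
      then show "s \<otimes> t \<in> M"
        using ab Mi Msub by (auto simp: ideal.I_l_closed ideal.I_r_closed subset_iff)
    qed (use ab Msub in auto)
  qed
  finally have "good M"
    using Ps(1) Qs(1) unfolding good_def by (intro exI[of _ "Ps @ Qs"]) auto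
  then show False using bad by simp
qed

text \<open>In positive height one may take \<open>c\<^sub>2 = \<zero>\<close>; the summand \<open>c\<^sub>2\<close> takes care of the
  minimal primes that contain \<open>I\<close>.\<close>

lemma (in noetherian_ring) ex_pow_add_annihilator_avoiding_minimal_primes:
  assumes "cring R" "ideal I R" "x \<in> carrier R"
    and rad: "\<And>P. \<lbrakk>primeideal P R; I \<subseteq> P\<rbrakk> \<Longrightarrow> x \<in> P"
  obtains r :: nat where "\<And>k. \<exists>c\<^sub>1 \<in> ideal_pow R I k. \<exists>c\<^sub>2 \<in> carrier R.
    c\<^sub>2 \<otimes> x [^] r = \<zero> \<and> (\<forall>P. minimal_prime R P \<longrightarrow> c\<^sub>1 \<oplus> c\<^sub>2 \<notin> P)"
proof -
  interpret cring R by fact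
  obtain Ps where Ps: "\<forall>P \<in> set Ps. primeideal P R" "foldr (\<cdot>) Ps (carrier R) \<subseteq> {\<zero>}"
    using ex_prime_list_prod_subset[OF assms(1) zeroideal] by blast
  define r where "r = length Ps"
  \<comment> \<open>A prime contains the zero product of \<open>Ps\<close>, hence some entry of it;
    minimality turns this inclusion into equality.\<close>
  have "P \<in> set Ps" if P: "minimal_prime R P" for P
  proof -
    have "primeideal P R" using P by (simp add: minimal_prime_def)
    moreover have "foldr (\<cdot>) Ps (carrier R) \<subseteq> P"
      using calculation Ps(2) ideal_zero_closed[of P] by (auto simp: primeideal_def)
    ultimately obtain Q where "Q \<in> set Ps" "Q \<subseteq> P"
      using primeideal_foldr_ideal_prod_subset[of P Ps] Ps(1) by (auto simp: primeideal_def)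
    then show ?thesis using P Ps(1) by (auto simp: minimal_prime_def)
  qed
  then have fin: "finite {P. minimal_prime R P}"
    by (auto intro: finite_subset[OF _ finite_set[of Ps]])
  have "\<exists>c\<^sub>1 \<in> ideal_pow R I k. \<exists>c\<^sub>2 \<in> carrier R.
    c\<^sub>2 \<otimes> x [^] r = \<zero> \<and> (\<forall>P. minimal_prime R P \<longrightarrow> c\<^sub>1 \<oplus> c\<^sub>2 \<notin> P)" for k
  proof -
    define A where "A = {c \<in> carrier R. c \<otimes> x [^] r \<in> {\<zero>}}"
    have A: "ideal A R"
      unfolding A_def using assms(3) by (intro colon_ideal zeroideal) auto
    have Ik: "ideal (ideal_pow R I k) R" using assms(2) by simp
    \<comment> \<open>The sum of the power of \<open>I\<close> and the annihilator of x^r. Prime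
      avoidance in \<open>B\<close> gives an element whose two summands are \<open>c\<^sub>1\<close>
      and \<open>c\<^sub>2\<close>.\<close>
    define B where "B = set_add R (ideal_pow R I k) A"
    have B: "ideal B R" unfolding B_def by (rule add_ideals[OF Ik A])
    have sub: "ideal_pow R I k \<subseteq> B" "A \<subseteq> B"
      unfolding B_def union_genideal[OF Ik A, symmetric]
      using genideal_self[of "ideal_pow R I k \<union> A"] ideal.Icarr[OF Ik] ideal.Icarr[OF A] by auto
    have "\<not> B \<subseteq> P" if P: "minimal_prime R P" for P
    proof
      assume BP: "B \<subseteq> P"
      have prime: "primeideal P R" using P by (simp add: minimal_prime_def)
      then have "I \<subseteq> P"
        using primeideal_ideal_pow_subset[OF prime assms(2)] sub BP by blast
      \<comment> \<open>As \<open>P\<close> contains \<open>I\<close> and so \<open>x\<close>, some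
        \<open>u\<close> outside \<open>P\<close> annihilates x^r. Then \<open>u\<close> is in
        \<open>A\<close> and thus in \<open>P\<close>, a contradiction.\<close>
      then have "x \<in> P" using rad prime by blast
      then obtain u where "u \<in> carrier R - P" "u \<otimes> x [^] r \<in> foldr (\<cdot>) Ps (carrier R)"
        using minimal_prime_annihilator[OF P, of x Ps] Ps(1) by (auto simp: r_def)
      then show False using Ps(2) sub BP by (auto simp: A_def)
    qed
    then have "\<exists>b \<in> B. \<forall>P \<in> {P. minimal_prime R P}. b \<notin> P"
      by (intro prime_avoidance_antichain fin B) (auto simp: minimal_prime_def)
    then obtain b where b: "b \<in> B" "\<And>P. minimal_prime R P \<Longrightarrow> b \<notin> P" by auto
    then obtain c1 c2 where "c1 \<in> ideal_pow R I k" "c2 \<in> A" "b = c1 \<oplus> c2"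
      unfolding B_def set_add_def' by blast
    then show ?thesis using b(2) by (auto simp: A_def)
  qed
  then show thesis by (rule that)
qed

section \<open>Special parts of integral and tight closure\<close>

text \<open>Finite generation makes the set under \<open>LEAST\<close> nonempty, so the minimum is
  attained.\<close>

lemma (in noetherian_ring) ex_min_num_gens:
  assumes "ideal I R"
  shows "\<exists>S \<subseteq> carrier R. finite S \<and> card S = min_num_gens R I \<and> I = Idl S"
  unfolding min_num_gens_def
  by (rule LeastI_ex) (use finetely_gen[OF assms] in blast)

theorem proposition7p4:
  fixes R :: "('a, 'b) ring_scheme" and \<mm> I :: "'a set" and p n w :: nat
  assumes "noetherian_local_ring R \<mm>"
    and "Factorial_Ring.prime p" and "ring_char R = p"
    and "ideal I R" and "I \<noteq> carrier R"
    and "n = min_num_gens R I"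
    and "0 < n + w"
  shows "integral_closure_sp R \<mm> (ideal_pow R I (n + w))
           \<subseteq> tight_closure_sp R \<mm> p (ideal_pow R I (w + 1))"
proof
  interpret noetherian_local_ring R \<mm> by fact
  have mi: "ideal \<mm> R" using maximalideal_\<mm> by (simp add: maximalideal_def)
  note I = \<open>ideal I R\<close>
  define d where "d = n + w"
  have d: "0 < d" using assms(7) by (simp add: d_def)
  have p: "2 \<le> p" using assms(2) by (simp add: prime_ge_2_nat)
  obtain S where S: "S \<subseteq> carrier R" "finite S" "I = Idl\<^bsub>R\<^esub> S" "card S = n"
    using ex_min_num_gens[OF I] assms(6) by blast
  obtain T where T: "T \<subseteq> carrier R" "finite T" "\<mm> = Idl\<^bsub>R\<^esub> T"
    using finetely_gen[OF mi] by blast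
  fix x assume "x \<in> integral_closure_sp R \<mm> (ideal_pow R I (n + w))"
  then obtain s where x: "x \<in> carrier R" and s: "1 \<le> s"
    and int: "x [^]\<^bsub>R\<^esub> s \<in> integral_closure R (\<mm> \<cdot>\<^bsub>R\<^esub> ideal_pow R I (d * s))"
    unfolding integral_closure_sp_def by (auto simp: ideal_pow_pow[OF I] d_def)
  define A where "A = \<mm> \<cdot>\<^bsub>R\<^esub> ideal_pow R I (d * s)"
  have A: "ideal A R" unfolding A_def by (simp add: ideal_prod_is_ideal mi I)
  obtain N where N: "\<And>k. (x [^]\<^bsub>R\<^esub> s) [^]\<^bsub>R\<^esub> k \<in> ideal_pow R A (k - N)"
    using integral_closure_pow_mem[OF A int[folded A_def]] by blast
  have Apow: "ideal_pow R A k = ideal_pow R \<mm> k \<cdot>\<^bsub>R\<^esub> ideal_pow R I (d * s * k)" for k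
    unfolding A_def by (simp add: ideal_pow_prod mi I ideal_pow_pow)
  have "x \<in> P" if P: "primeideal P R" and "I \<subseteq> P" for P
  proof -
    \<comment> \<open>The exponent \<open>Suc N\<close> leaves the first power of \<open>A\<close>
      after the loss of \<open>N\<close>. Positivity of \<open>d\<close> and \<open>s\<close> then
      puts this power of \<open>x\<close> into \<open>I\<close>.\<close>
    have "(x [^]\<^bsub>R\<^esub> s) [^]\<^bsub>R\<^esub> Suc N \<in> A"
      using N[of "Suc N"] ideal_pow_1[OF A] by (simp add: Suc_diff_le del: nat_pow_Suc)
    also have "A \<subseteq> ideal_pow R I (d * s)"
      unfolding A_def using ideal_prod_inter[OF mi ideal_pow_ideal[OF I]] by blast
    also have "\<dots> \<subseteq> ideal_pow R I (Suc 0)"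
      using d s by (intro ideal_pow_antimono I) simp
    also have "\<dots> \<subseteq> P" using that by (simp add: ideal_pow_1 I)
    finally have "x [^]\<^bsub>R\<^esub> (s * Suc N) \<in> P" by (simp only: nat_pow_pow[OF x])
    then show ?thesis using primeideal_pow_mem[OF P x] by blast
  qed
  then obtain r :: nat where r: "\<And>k. \<exists>c\<^sub>1 \<in> ideal_pow R I k. \<exists>c\<^sub>2 \<in> carrier R.
      c\<^sub>2 \<otimes>\<^bsub>R\<^esub> x [^]\<^bsub>R\<^esub> r = \<zero>\<^bsub>R\<^esub> \<and> (\<forall>P. minimal_prime R P \<longrightarrow> c\<^sub>1 \<oplus>\<^bsub>R\<^esub> c\<^sub>2 \<notin> P)"
    using ex_pow_add_annihilator_avoiding_minimal_primes[OF is_cring I x] by blast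
  \<comment> \<open>In the exponent \<open>d * s * (N + 1)\<close>, the \<open>N\<close> makes up
    for the loss in \<open>k - N\<close> and the extra 1 for rounding down in
    \<open>k = Q div s\<close> below.\<close>
  obtain c1 c2 where c1: "c1 \<in> ideal_pow R I (d * s * (N + 1))" and c2: "c2 \<in> carrier R"
    and c2x: "c2 \<otimes>\<^bsub>R\<^esub> x [^]\<^bsub>R\<^esub> r = \<zero>\<^bsub>R\<^esub>"
    and avoid: "\<forall>P. minimal_prime R P \<longrightarrow> c1 \<oplus>\<^bsub>R\<^esub> c2 \<notin> P"
    using r by blast
  have c1c: "c1 \<in> carrier R" using c1 ideal.Icarr[OF ideal_pow_ideal[OF I]] by blast

  \<comment> \<open>Chosen so that \<open>e < 2 ^ e \<le> q0\<close>: then \<open>q0\<close> exceeds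
    both summands, the first for the power of \<mm>, the second for the annihilator
    \<open>c2\<close>.\<close>
  define e where "e = s * (card T + N + 1) + r"
  define q0 where "q0 = p ^ e"
  have "e < 2 ^ e" by (rule less_exp)
  also have "\<dots> \<le> q0" unfolding q0_def using p by (intro power_mono) auto
  finally have q0: "s * (card T + N + 1) \<le> q0" "r \<le> q0" by (auto simp: e_def)
  define J where "J = ideal_pow R I (w + 1)"
  have J: "ideal J R" by (simp add: J_def I)

  have main: "(c1 \<oplus>\<^bsub>R\<^esub> c2) \<otimes>\<^bsub>R\<^esub> (x [^]\<^bsub>R\<^esub> q0) [^]\<^bsub>R\<^esub> q
      \<in> frobenius_power R (\<mm> \<cdot>\<^bsub>R\<^esub> frobenius_power R J q0) q" if q: "0 < q" for q
  proof -
    define Q where "Q = q0 * q"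
    have q0Q: "q0 \<le> Q" using q by (simp add: Q_def)
    have q0pos: "0 < q0" using p by (simp add: q0_def)
    define k where "k = Q div s"
    have "(card T + N + 1) * q \<le> k"
    proof -
      have "s * (card T + N + 1) * q \<le> Q" unfolding Q_def using q0(1) by (intro mult_right_mono) auto
      then have "(s * ((card T + N + 1) * q)) div s \<le> k"
        unfolding k_def by (intro div_le_mono) (simp only: mult.assoc)
      then show ?thesis using s by simp
    qed
    \<comment> \<open>Of the lower bound for \<open>k\<close>, the part \<open>(N + 1) * q\<close>
      absorbs the loss \<open>N\<close> and leaves \<open>k - N\<close> positive, while
      \<open>card T * q\<close> remains for the pigeonhole argument. The term \<open>0 * q\<close>
      matches that lemma at \<open>w = 0\<close>.\<close>
    moreover have "N + 1 \<le> (N + 1) * q" using q mult_le_mono2[of 1 q "N + 1"] by simp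
    ultimately have kN: "card T * q + 0 * q \<le> k - N" "0 < k - N"
      by (simp_all add: algebra_simps)
    have "Q mod s < s" using s by simp
    then have Qk: "Q \<le> s * (k + 1)"
      unfolding k_def using mult_div_mod_eq[of s Q] by (simp only: distrib_left)
    have xQ: "x [^]\<^bsub>R\<^esub> Q = (x [^]\<^bsub>R\<^esub> s) [^]\<^bsub>R\<^esub> k \<otimes>\<^bsub>R\<^esub> x [^]\<^bsub>R\<^esub> (Q mod s)"
      unfolding k_def by (simp add: nat_pow_pow nat_pow_mult x)

    let ?K = "ideal_pow R \<mm> (k - N) \<cdot>\<^bsub>R\<^esub> ideal_pow R I (d * Q)"
    have K: "ideal ?K R" by (simp add: ideal_prod_is_ideal mi I)
    have "(x [^]\<^bsub>R\<^esub> s) [^]\<^bsub>R\<^esub> k \<otimes>\<^bsub>R\<^esub> c1 \<in> ideal_pow R A (k - N) \<cdot>\<^bsub>R\<^esub> ideal_pow R I (d * s * (N + 1))"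
      by (rule ideal_prod.prod[OF N c1])
    also have "\<dots> = ideal_pow R \<mm> (k - N) \<cdot>\<^bsub>R\<^esub> ideal_pow R I (d * s * (k + 1))"
    proof -
      have "d * s * (k - N) + d * s * (N + 1) = d * s * (k - N + (N + 1))"
        by (simp only: distrib_left)
      also have "k - N + (N + 1) = k + 1" using kN(2) by simp
      finally show ?thesis
        unfolding Apow by (simp only: ideal_prod_assoc mi I ideal_pow_ideal ideal_pow_add)
    qed
    also have "\<dots> \<subseteq> ?K"
      using mult_le_mono2[OF Qk, of d]
      by (intro ideal_prod_mono order_refl ideal_pow_antimono I) (simp only: mult.assoc)
    finally have "(x [^]\<^bsub>R\<^esub> s) [^]\<^bsub>R\<^esub> k \<otimes>\<^bsub>R\<^esub> c1 \<otimes>\<^bsub>R\<^esub> x [^]\<^bsub>R\<^esub> (Q mod s) \<in> ?K"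
      using x by (simp add: ideal.I_r_closed[OF K])
    moreover have "(x [^]\<^bsub>R\<^esub> s) [^]\<^bsub>R\<^esub> k \<otimes>\<^bsub>R\<^esub> c1 \<otimes>\<^bsub>R\<^esub> x [^]\<^bsub>R\<^esub> (Q mod s) = c1 \<otimes>\<^bsub>R\<^esub> x [^]\<^bsub>R\<^esub> Q"
      unfolding xQ using c1c x by (simp only: m_ac nat_pow_closed m_closed)
    ultimately have "c1 \<otimes>\<^bsub>R\<^esub> x [^]\<^bsub>R\<^esub> Q \<in> ?K" by simp
    also have "?K \<subseteq> frobenius_power R \<mm> q \<cdot>\<^bsub>R\<^esub> frobenius_power R J Q"
    proof (rule ideal_prod_mono)
      show "ideal_pow R \<mm> (k - N) \<subseteq> frobenius_power R \<mm> q"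
        using ideal_pow_subset_frobenius_power[OF T q kN(2,1)] by (simp add: ideal_pow_1 mi)
      \<comment> \<open>Since \<open>d = n + w\<close> and \<open>S\<close> has \<open>n\<close>
        elements, \<open>d * Q\<close> is exactly the pigeonhole bound
        \<open>card S * Q + w * Q\<close>.\<close>
      show "ideal_pow R I (d * Q) \<subseteq> frobenius_power R J Q"
        unfolding J_def using q0pos q d
        by (intro ideal_pow_subset_frobenius_power[OF S(1-3)])
           (auto simp: Q_def d_def S(4) algebra_simps)
    qed
    also have "\<dots> \<subseteq> frobenius_power R (\<mm> \<cdot>\<^bsub>R\<^esub> frobenius_power R J q0) q"
      unfolding Q_def by (rule frobenius_power_prod_subset[OF mi J])
    finally have "c1 \<otimes>\<^bsub>R\<^esub> x [^]\<^bsub>R\<^esub> Q \<in> \<dots>" .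
    moreover have "c2 \<otimes>\<^bsub>R\<^esub> x [^]\<^bsub>R\<^esub> Q = \<zero>\<^bsub>R\<^esub>"
    proof -
      have "x [^]\<^bsub>R\<^esub> Q = x [^]\<^bsub>R\<^esub> r \<otimes>\<^bsub>R\<^esub> x [^]\<^bsub>R\<^esub> (Q - r)"
        using q0(2) q0Q x by (simp add: nat_pow_mult)
      then have "c2 \<otimes>\<^bsub>R\<^esub> x [^]\<^bsub>R\<^esub> Q = c2 \<otimes>\<^bsub>R\<^esub> x [^]\<^bsub>R\<^esub> r \<otimes>\<^bsub>R\<^esub> x [^]\<^bsub>R\<^esub> (Q - r)"
        using c2 x by (simp add: m_assoc)
      then show ?thesis using c2x x by simp
    qed
    ultimately show ?thesis
      using c1c c2 x by (simp add: nat_pow_pow l_distr Q_def)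
  qed

  \<comment> \<open>\<open>main\<close> holds for every positive \<open>q\<close> with the same
    multiplier, so the threshold exponent can be 0.\<close>
  have "x [^]\<^bsub>R\<^esub> q0 \<in> tight_closure R p (\<mm> \<cdot>\<^bsub>R\<^esub> frobenius_power R J q0)"
    unfolding tight_closure_def
    using x c1c c2 avoid main p by (auto intro!: bexI[of _ "c1 \<oplus>\<^bsub>R\<^esub> c2"] exI[of _ "0::nat"])
  then show "x \<in> tight_closure_sp R \<mm> p (ideal_pow R I (w + 1))"
    unfolding tight_closure_sp_def J_def q0_def using x by blast
qed

end
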